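(* Let $R$ be a commutative ring, let $\mathfrak{a}\subseteq R$ be an ideal, and let $M$ be an $R$-module. Then: a) $\mathrm{Ass}_R(\Gamma_{\mathfrak{a}}(M))=\mathrm{Ass}_R(M)\cap\mathrm{Var}(\mathfrak{a})$. b) $\mathrm{Ass}^{\rm f}_R(\Gamma_{\mathfrak{a}}(M))\subseteq\mathrm{Ass}^{\rm f}_R(M)\cap\mathrm{Var}(\mathfrak{a})$. c) $\mathrm{Ass}_R(M/\Gamma_{\mathfrak{a}}(M))\supseteq\mathrm{Ass}_R(M)\setminus\mathrm{Var}(\mathfrak{a})$. d) $\mathrm{Ass}^{\rm f}_R(M/\Gamma_{\mathfrak{a}}(M))\supseteq\mathrm{Ass}^{\rm f}_R(M)\setminus\mathrm{Var}(\mathfrak{a})$.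
   Context: Rings are commutative with unit (not assumed noetherian). For an ideal $\mathfrak{a}\subseteq R$, $\mathrm{Var}(\mathfrak{a})$ is the set of prime ideals of $R$ containing $\mathfrak{a}$, and $\Gamma_{\mathfrak{a}}(M)=\bigcup_{n\in\mathbb{N}}(0:_M\mathfrak{a}^n)=\{x\in M\mid\exists n\in\mathbb{N}:\mathfrak{a}^nx=0\}$ is the $\mathfrak{a}$-torsion submodule of $M$. For $x\in M$, $(0:_Rx)=\{r\in R\mid rx=0\}$. The assassin $\mathrm{Ass}_R(M)$ is the set of prime ideals of $R$ of the form $(0:_Rx)$ for some $x\in M$. The weak assassin $\mathrm{Ass}^{\rm f}_R(M)$ is the set of prime ideals $\mathfrak{p}$ of $R$ such that there exists $x\in M$ for which $\mathfrak{p}$ is minimal (with respect to inclusion) among the prime ideals containing $(0:_Rx)$. *)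

theory Defs
  imports "HOL-Algebra.Module" "HOL-Algebra.QuotRing" "HOL-Algebra.Ideal_Product"
begin

definition Var :: "('r, 's) ring_scheme \<Rightarrow> 'r set \<Rightarrow> 'r set set"
  where "Var R \<aa> = {\<pp>. primeideal \<pp> R \<and> \<aa> \<subseteq> \<pp>}"

definition elt_ann :: "('r, 's) ring_scheme \<Rightarrow> ('r, 'm, 'n) module_scheme \<Rightarrow> 'm \<Rightarrow> 'r set"
  where "elt_ann R M x = {r \<in> carrier R. r \<odot>\<^bsub>M\<^esub> x = \<zero>\<^bsub>M\<^esub>}"

text \<open>
  Powers of an ideal are taken in the multiplicative monoid of ideals, so \<open>\<aa>\<^sup>0 = R\<close> and
  \<open>\<aa>\<^sup>n\<close> consists of all finite sums of \<open>n\<close>-fold products.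
\<close>

definition ideal_power :: "('r, 's) ring_scheme \<Rightarrow> 'r set \<Rightarrow> nat \<Rightarrow> 'r set"
  where "ideal_power R \<aa> n = \<aa> [^]\<^bsub>ideals_set R\<^esub> n"

definition torsion ::
    "('r, 's) ring_scheme \<Rightarrow> 'r set \<Rightarrow> ('r, 'm, 'n) module_scheme \<Rightarrow> 'm set"
  where "torsion R \<aa> M =
    (\<Union>n. {x \<in> carrier M. \<forall>r \<in> ideal_power R \<aa> n. r \<odot>\<^bsub>M\<^esub> x = \<zero>\<^bsub>M\<^esub>})"

definition submod :: "('r, 'm, 'n) module_scheme \<Rightarrow> 'm set \<Rightarrow> ('r, 'm, 'n) module_scheme"
  where "submod M N = M\<lparr>carrier := N\<rparr>"

text \<open>
  As for \<^const>\<open>FactRing\<close>, the elements of the quotient are the additive cosets. The fields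
  \<^const>\<open>mult\<close> and \<^const>\<open>one\<close> exist only because the module record extends
  the ring record; they play no role for modules.
\<close>

definition quot_mod :: "('r, 'm, 'n) module_scheme \<Rightarrow> 'm set \<Rightarrow> ('r, 'm set) module"
  where "quot_mod M N =
    \<lparr>carrier = a_rcosets\<^bsub>M\<^esub> N, mult = rcoset_mult M N,
     one = (N +>\<^bsub>M\<^esub> \<one>\<^bsub>M\<^esub>), zero = N, add = set_add M,
     smult = (\<lambda>r A. \<Union>x\<in>A. N +>\<^bsub>M\<^esub> (r \<odot>\<^bsub>M\<^esub> x))\<rparr>"

definition Ass :: "('r, 's) ring_scheme \<Rightarrow> ('r, 'm, 'n) module_scheme \<Rightarrow> 'r set set"
  where "Ass R M = {\<pp>. primeideal \<pp> R \<and> (\<exists>x \<in> carrier M. \<pp> = elt_ann R M x)}"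

definition weak_Ass :: "('r, 's) ring_scheme \<Rightarrow> ('r, 'm, 'n) module_scheme \<Rightarrow> 'r set set"
  where "weak_Ass R M =
    {\<pp>. primeideal \<pp> R \<and>
      (\<exists>x \<in> carrier M. \<pp> \<in> Var R (elt_ann R M x) \<and>
        (\<forall>\<qq> \<in> Var R (elt_ann R M x). \<qq> \<subseteq> \<pp> \<longrightarrow> \<qq> = \<pp>))}"


text \<open>The torsion is a submodule, and \<^const>\<open>quot_mod\<close> is the quotient module.\<close>

lemma ideal_power_0 [simp]: "ideal_power R \<aa> 0 = carrier R"
  by (simp add: ideal_power_def ideals_set_def nat_pow_def)

lemma ideal_power_Suc [simp]: "ideal_power R \<aa> (Suc n) = ideal_prod R (ideal_power R \<aa> n) \<aa>"
  by (simp add: ideal_power_def ideals_set_def nat_pow_def)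

lemma (in ring) ideal_power_ideal:
  assumes "ideal \<aa> R"
  shows "ideal (ideal_power R \<aa> n) R"
  by (induction n) (simp_all add: oneideal ideal_prod_is_ideal assms)

lemma (in ring) ideal_power_antimono:
  assumes "ideal \<aa> R" "m \<le> n"
  shows "ideal_power R \<aa> n \<subseteq> ideal_power R \<aa> m"
proof (rule lift_Suc_antimono_le[OF _ assms(2)])
  show "ideal_power R \<aa> (Suc k) \<subseteq> ideal_power R \<aa> k" for k
    using ideal_prod_inter[OF ideal_power_ideal[OF assms(1)] assms(1)] by auto
qed

lemma (in module) torsion_submodule:
  assumes "ideal \<aa> R"
  shows "submodule (torsion R \<aa> M) R M"
proof -
  have pc: "r \<in> carrier R" if "r \<in> ideal_power R \<aa> n" for r n
    using ideal.Icarr[OF R.ideal_power_ideal[OF assms]] that by blast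
  show ?thesis
  proof (rule submoduleI)
    show "torsion R \<aa> M \<subseteq> carrier M"
      by (auto simp: torsion_def)
    show "\<zero>\<^bsub>M\<^esub> \<in> torsion R \<aa> M"
      using pc by (auto simp: torsion_def)
    show "\<ominus>\<^bsub>M\<^esub> x \<in> torsion R \<aa> M" if "x \<in> torsion R \<aa> M" for x
      using that pc by (fastforce simp: torsion_def smult_r_minus)
  next
    fix x y assume "x \<in> torsion R \<aa> M" "y \<in> torsion R \<aa> M"
    then obtain m n where x: "x \<in> carrier M" "\<And>r. r \<in> ideal_power R \<aa> m \<Longrightarrow> r \<odot>\<^bsub>M\<^esub> x = \<zero>\<^bsub>M\<^esub>"
      and y: "y \<in> carrier M" "\<And>r. r \<in> ideal_power R \<aa> n \<Longrightarrow> r \<odot>\<^bsub>M\<^esub> y = \<zero>\<^bsub>M\<^esub>"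
      by (auto simp: torsion_def)
    have "r \<odot>\<^bsub>M\<^esub> (x \<oplus>\<^bsub>M\<^esub> y) = \<zero>\<^bsub>M\<^esub>" if r: "r \<in> ideal_power R \<aa> (m + n)" for r
    proof -
      have "r \<in> ideal_power R \<aa> m" "r \<in> ideal_power R \<aa> n"
        using R.ideal_power_antimono[OF assms] r by (meson le_add1 le_add2 subsetD)+
      with x y pc[OF r] show ?thesis by (simp add: smult_r_distr)
    qed
    with x y show "x \<oplus>\<^bsub>M\<^esub> y \<in> torsion R \<aa> M"
      by (auto simp: torsion_def)
  next
    fix r x assume r: "r \<in> carrier R" and "x \<in> torsion R \<aa> M"
    then obtain n where x: "x \<in> carrier M" "\<And>s. s \<in> ideal_power R \<aa> n \<Longrightarrow> s \<odot>\<^bsub>M\<^esub> x = \<zero>\<^bsub>M\<^esub>"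
      by (auto simp: torsion_def)
    have "s \<odot>\<^bsub>M\<^esub> (r \<odot>\<^bsub>M\<^esub> x) = \<zero>\<^bsub>M\<^esub>" if s: "s \<in> ideal_power R \<aa> n" for s
    proof -
      have "s \<odot>\<^bsub>M\<^esub> (r \<odot>\<^bsub>M\<^esub> x) = r \<odot>\<^bsub>M\<^esub> (s \<odot>\<^bsub>M\<^esub> x)"
        using r x pc[OF s] by (metis smult_assoc1 R.m_comm)
      with x s r show ?thesis by simp
    qed
    with r x show "r \<odot>\<^bsub>M\<^esub> x \<in> torsion R \<aa> M"
      by (auto simp: torsion_def)
  qed
qed

lemma (in module) submod_module:
  assumes "submodule N R M"
  shows "module R (submod M N)"
  unfolding submod_def by (rule submodule.submodule_is_module[OF assms module_axioms])

lemma (in module) submodule_abelian_subgroup: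
  assumes "submodule N R M"
  shows "abelian_subgroup N M"
  using assms by (intro abelian_subgroupI3 additive_subgroupI M.abelian_group_axioms)
    (simp add: submodule_def)

lemma (in module) quot_mod_smult:
  assumes "submodule N R M" "r \<in> carrier R" "x \<in> carrier M"
  shows "r \<odot>\<^bsub>quot_mod M N\<^esub> (N +>\<^bsub>M\<^esub> x) = N +>\<^bsub>M\<^esub> (r \<odot>\<^bsub>M\<^esub> x)"
proof -
  interpret N: abelian_subgroup N M
    by (rule submodule_abelian_subgroup[OF assms(1)])
  have "N +>\<^bsub>M\<^esub> (r \<odot>\<^bsub>M\<^esub> y) = N +>\<^bsub>M\<^esub> (r \<odot>\<^bsub>M\<^esub> x)" if y: "y \<in> N +>\<^bsub>M\<^esub> x" for y
  proof -
    obtain h where h: "h \<in> N" "y = h \<oplus>\<^bsub>M\<^esub> x"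
      using y by (auto simp: a_r_coset_def')
    have "h \<in> carrier M" using h by simp
    then have "r \<odot>\<^bsub>M\<^esub> y = r \<odot>\<^bsub>M\<^esub> h \<oplus>\<^bsub>M\<^esub> r \<odot>\<^bsub>M\<^esub> x"
      using h assms by (simp add: smult_r_distr)
    moreover have "r \<odot>\<^bsub>M\<^esub> h \<in> N"
      using submodule.smult_closed[OF assms(1)] assms h by blast
    ultimately have "r \<odot>\<^bsub>M\<^esub> y \<in> N +>\<^bsub>M\<^esub> (r \<odot>\<^bsub>M\<^esub> x)"
      by (auto simp: a_r_coset_def')
    then show ?thesis
      using N.a_repr_independence' assms N.a_subgroup smult_closed by metis
  qed
  moreover have "x \<in> N +>\<^bsub>M\<^esub> x"
    using N.a_rcos_self assms by blast
  ultimately have "(\<Union>y \<in> N +>\<^bsub>M\<^esub> x. N +>\<^bsub>M\<^esub> (r \<odot>\<^bsub>M\<^esub> y)) = N +>\<^bsub>M\<^esub> (r \<odot>\<^bsub>M\<^esub> x)"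
    by blast
  then show ?thesis
    unfolding quot_mod_def by simp
qed

lemma (in module) quot_mod_module:
  assumes N: "submodule N R M"
  shows "module R (quot_mod M N)"
proof -
  interpret N: abelian_subgroup N M
    by (rule submodule_abelian_subgroup[OF N])
  let ?Q = "quot_mod M N"
  have carr: "carrier ?Q = (\<lambda>x. N +>\<^bsub>M\<^esub> x) ` carrier M"
    by (auto simp: quot_mod_def A_RCOSETS_def')
  have add: "(N +>\<^bsub>M\<^esub> x) \<oplus>\<^bsub>?Q\<^esub> (N +>\<^bsub>M\<^esub> y) = N +>\<^bsub>M\<^esub> (x \<oplus>\<^bsub>M\<^esub> y)"
    if "x \<in> carrier M" "y \<in> carrier M" for x y
    using N.a_rcos_sum that by (simp add: quot_mod_def)
  have zero: "\<zero>\<^bsub>?Q\<^esub> = N +>\<^bsub>M\<^esub> \<zero>\<^bsub>M\<^esub>"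
    using N.a_subset by (simp add: quot_mod_def)
  note smult = quot_mod_smult[OF N]
  have ab: "abelian_group ?Q"
  proof (rule abelian_groupI)
    fix A assume "A \<in> carrier ?Q"
    then obtain x where x: "x \<in> carrier M" "A = N +>\<^bsub>M\<^esub> x"
      by (auto simp: carr)
    have "(N +>\<^bsub>M\<^esub> (\<ominus>\<^bsub>M\<^esub> x)) \<oplus>\<^bsub>?Q\<^esub> A = \<zero>\<^bsub>?Q\<^esub>"
      using x by (simp add: add zero M.l_neg)
    then show "\<exists>B\<in>carrier ?Q. B \<oplus>\<^bsub>?Q\<^esub> A = \<zero>\<^bsub>?Q\<^esub>"
      using x by (auto simp: carr)
  qed (auto simp: carr add zero M.a_ac)
  show ?thesis
    by (rule moduleI[OF R.is_cring ab])
      (auto simp: carr add zero smult smult_l_distr smult_r_distr smult_assoc1)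
qed

end

theory Submission
  imports Defs
begin

text \<open>
  Whether a prime \<open>\<pp>\<close> belongs to an assassin or a weak assassin depends only on the
  annihilators of single elements: \<open>\<pp>\<close> equals such an annihilator or is minimal over it. Hence
  it suffices to know how annihilators behave in \<open>\<Gamma>\<close>, the torsion submodule, and in
  \<open>M/\<Gamma>\<close>.

  An element of \<open>\<Gamma>\<close> has the same annihilator in \<open>\<Gamma>\<close> as in \<open>M\<close>, and this
  annihilator contains some \<open>\<aa>\<^sup>n\<close>, so every prime above it contains \<open>\<aa>\<close>
  (\<open>torsion_ann_subset_prime\<close>). Conversely, if \<open>\<aa>\<close> kills \<open>x\<close> then \<open>x\<close> is a torsion
  element. This is all that concerns \<open>\<Gamma>\<close>.

  For the quotient, let \<open>\<pp>\<close> be a prime above the annihilator of \<open>x\<close> that does not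
  contain \<open>\<aa>\<close>. Passing from \<open>x\<close> to its coset enlarges the annihilator, but not beyond
  \<open>\<pp>\<close> (\<open>elt_ann_coset_subset_prime\<close>): if \<open>\<aa>\<^sup>n r\<close> kills \<open>x\<close>, then
  \<open>\<aa>\<^sup>n r \<subseteq> \<pp>\<close>, and \<open>\<aa>\<^sup>n\<close> is not contained in \<open>\<pp>\<close>, so \<open>r \<in> \<pp>\<close>. If
  \<open>\<pp>\<close> is the annihilator of \<open>x\<close>, it is therefore that of the coset; if \<open>\<pp>\<close> is
  minimal over the annihilator of \<open>x\<close>, it stays minimal over the larger annihilator, which
  has fewer primes above it.
\<close>

lemma (in primeideal) ideal_power_subset_imp_subset:
  assumes \<aa>: "ideal \<aa> R" and sub: "ideal_power R \<aa> n \<subseteq> I"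
  shows "\<aa> \<subseteq> I"
  using sub
proof (induction n)
  case 0
  \<comment> \<open>The zeroth power is the whole ring, which no prime contains.\<close>
  then show ?case
    using I_notcarr a_subset by auto
next
  case (Suc n)
  then show ?case
    using primeideal_divides_ideal_prod[OF primeideal_axioms ideal_power_ideal[OF \<aa>] \<aa>]
    by auto
qed

lemma elt_ann_submod [simp]: "elt_ann R (submod M N) x = elt_ann R M x"
  by (simp add: elt_ann_def submod_def)

lemma carrier_submod [simp]: "carrier (submod M N) = N"
  by (simp add: submod_def)

lemma (in module) torsion_ann_subset_prime:
  assumes \<aa>: "ideal \<aa> R" and x: "x \<in> torsion R \<aa> M"
    and \<pp>: "primeideal \<pp> R" and ann: "elt_ann R M x \<subseteq> \<pp>"
  shows "\<aa> \<subseteq> \<pp>"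
proof -
  obtain n where n: "\<forall>r \<in> ideal_power R \<aa> n. r \<odot>\<^bsub>M\<^esub> x = \<zero>\<^bsub>M\<^esub>"
    using x by (auto simp: torsion_def)
  have "ideal_power R \<aa> n \<subseteq> elt_ann R M x"
    using n ideal.Icarr[OF R.ideal_power_ideal[OF \<aa>]] by (auto simp: elt_ann_def)
  with ann show ?thesis
    using primeideal.ideal_power_subset_imp_subset[OF \<pp> \<aa>] by blast
qed

lemma (in module) subset_ann_imp_torsion:
  assumes \<aa>: "ideal \<aa> R" and x: "x \<in> carrier M" and ann: "\<aa> \<subseteq> elt_ann R M x"
  shows "x \<in> torsion R \<aa> M"
proof -
  have "ideal_power R \<aa> 1 = \<aa>"
    using R.ideal_prod_one[OF \<aa>] R.ideal_prod_commute[OF \<aa> R.oneideal] by simp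
  with x ann have "x \<in> {x \<in> carrier M. \<forall>r \<in> ideal_power R \<aa> 1. r \<odot>\<^bsub>M\<^esub> x = \<zero>\<^bsub>M\<^esub>}"
    by (auto simp: elt_ann_def)
  then show ?thesis
    unfolding torsion_def by blast
qed

lemma (in module) elt_ann_quot_mod:
  assumes N: "submodule N R M" and x: "x \<in> carrier M"
  shows "elt_ann R (quot_mod M N) (N +>\<^bsub>M\<^esub> x) = {r \<in> carrier R. r \<odot>\<^bsub>M\<^esub> x \<in> N}"
proof -
  interpret N: abelian_subgroup N M
    by (rule submodule_abelian_subgroup[OF N])
  have "N +>\<^bsub>M\<^esub> y = N \<longleftrightarrow> y \<in> N" if "y \<in> carrier M" for y
    using that N.a_rcos_self N.a_rcos_const by blast
  moreover have "\<zero>\<^bsub>quot_mod M N\<^esub> = N"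
    by (simp add: quot_mod_def)
  ultimately show ?thesis
    using quot_mod_smult[OF N _ x] smult_closed[OF _ x] unfolding elt_ann_def
    by (intro Collect_cong conj_cong) simp_all
qed

lemma (in module) elt_ann_subset_elt_ann_coset:
  assumes N: "submodule N R M" and x: "x \<in> carrier M"
  shows "elt_ann R M x \<subseteq> elt_ann R (quot_mod M N) (N +>\<^bsub>M\<^esub> x)"
proof -
  interpret N: abelian_subgroup N M
    by (rule submodule_abelian_subgroup[OF N])
  show ?thesis
    unfolding elt_ann_quot_mod[OF N x] by (auto simp: elt_ann_def)
qed

text \<open>
  Primality is used twice: it provides an element \<open>s\<close> of \<open>\<aa>\<^sup>n\<close> outside \<open>\<pp>\<close>, and it
  allows \<open>s\<close> to be cancelled from \<open>s r \<in> \<pp>\<close>. The exponent \<open>n\<close> may depend on \<open>r\<close>.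
\<close>

lemma (in module) elt_ann_coset_subset_prime:
  assumes \<aa>: "ideal \<aa> R" and x: "x \<in> carrier M"
    and \<pp>: "primeideal \<pp> R" and ann: "elt_ann R M x \<subseteq> \<pp>" and not_sub: "\<not> \<aa> \<subseteq> \<pp>"
  shows "elt_ann R (quot_mod M (torsion R \<aa> M)) (torsion R \<aa> M +>\<^bsub>M\<^esub> x) \<subseteq> \<pp>"
proof
  fix r assume "r \<in> elt_ann R (quot_mod M (torsion R \<aa> M)) (torsion R \<aa> M +>\<^bsub>M\<^esub> x)"
  then have r: "r \<in> carrier R" and "r \<odot>\<^bsub>M\<^esub> x \<in> torsion R \<aa> M"
    by (auto simp: elt_ann_quot_mod[OF torsion_submodule[OF \<aa>] x])
  then obtain n where n: "\<forall>s \<in> ideal_power R \<aa> n. s \<odot>\<^bsub>M\<^esub> (r \<odot>\<^bsub>M\<^esub> x) = \<zero>\<^bsub>M\<^esub>"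
    by (auto simp: torsion_def)
  obtain s where s: "s \<in> ideal_power R \<aa> n" "s \<notin> \<pp>"
    using primeideal.ideal_power_subset_imp_subset[OF \<pp> \<aa>] not_sub by blast
  have sR: "s \<in> carrier R"
    using ideal.Icarr[OF R.ideal_power_ideal[OF \<aa>]] s by blast
  have "s \<otimes>\<^bsub>R\<^esub> r \<in> elt_ann R M x"
    using n s sR r x by (simp add: elt_ann_def smult_assoc1)
  with ann have "s \<otimes>\<^bsub>R\<^esub> r \<in> \<pp>"
    by blast
  then show "r \<in> \<pp>"
    using primeideal.I_prime[OF \<pp> sR r] s by blast
qed

theorem mainTheorem1:
  fixes R :: "('r, 's) ring_scheme"
    and M :: "('r, 'm, 'n) module_scheme"
    and \<aa> :: "'r set"
  assumes "cring R"
    and "ideal \<aa> R"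
    and "module R M"
  shows "Ass R (submod M (torsion R \<aa> M)) = Ass R M \<inter> Var R \<aa>
    \<and> weak_Ass R (submod M (torsion R \<aa> M)) \<subseteq> weak_Ass R M \<inter> Var R \<aa>
    \<and> Ass R (quot_mod M (torsion R \<aa> M)) \<supseteq> Ass R M - Var R \<aa>
    \<and> weak_Ass R (quot_mod M (torsion R \<aa> M)) \<supseteq> weak_Ass R M - Var R \<aa>"
proof -
  interpret module R M by fact
  note \<aa> = \<open>ideal \<aa> R\<close>
  let ?T = "torsion R \<aa> M"
  let ?Q = "quot_mod M ?T"
  have T: "submodule ?T R M"
    by (rule torsion_submodule[OF \<aa>])
  have T_carrier: "x \<in> carrier M" if "x \<in> ?T" for x
    using that by (auto simp: torsion_def)
  have coset: "?T +>\<^bsub>M\<^esub> x \<in> carrier ?Q" if "x \<in> carrier M" for x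
    using that by (auto simp: quot_mod_def A_RCOSETS_def')
  note enlarge = elt_ann_subset_elt_ann_coset[OF T]
  note bound = elt_ann_coset_subset_prime[OF \<aa>]
  show ?thesis
  proof (intro conjI equalityI subsetI)
    fix \<pp> assume "\<pp> \<in> Ass R (submod M ?T)"
    then obtain x where \<pp>: "primeideal \<pp> R" and x: "x \<in> ?T" "\<pp> = elt_ann R M x"
      by (auto simp: Ass_def)
    then show "\<pp> \<in> Ass R M \<inter> Var R \<aa>"
      using torsion_ann_subset_prime[OF \<aa> x(1) \<pp>] T_carrier by (auto simp: Ass_def Var_def)
  next
    fix \<pp> assume "\<pp> \<in> Ass R M \<inter> Var R \<aa>"
    then obtain x where \<pp>: "primeideal \<pp> R" "\<aa> \<subseteq> \<pp>"
      and x: "x \<in> carrier M" "\<pp> = elt_ann R M x"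
      by (auto simp: Ass_def Var_def)
    then show "\<pp> \<in> Ass R (submod M ?T)"
      using subset_ann_imp_torsion[OF \<aa> x(1)] by (auto simp: Ass_def)
  next
    fix \<pp> assume "\<pp> \<in> weak_Ass R (submod M ?T)"
    then obtain x where \<pp>: "primeideal \<pp> R" and x: "x \<in> ?T" "elt_ann R M x \<subseteq> \<pp>"
      and min: "\<forall>\<qq> \<in> Var R (elt_ann R M x). \<qq> \<subseteq> \<pp> \<longrightarrow> \<qq> = \<pp>"
      by (auto simp: weak_Ass_def Var_def)
    then show "\<pp> \<in> weak_Ass R M \<inter> Var R \<aa>"
      using torsion_ann_subset_prime[OF \<aa> x(1) \<pp>] T_carrier
      by (auto simp: weak_Ass_def Var_def)
  next
    fix \<pp> assume "\<pp> \<in> Ass R M - Var R \<aa>"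
    then obtain x where \<pp>: "primeideal \<pp> R" "\<not> \<aa> \<subseteq> \<pp>"
      and x: "x \<in> carrier M" "\<pp> = elt_ann R M x"
      by (auto simp: Ass_def Var_def)
    have "\<pp> = elt_ann R ?Q (?T +>\<^bsub>M\<^esub> x)"
      using enlarge[OF x(1)] bound[OF x(1) \<pp>(1) _ \<pp>(2)] x(2) by blast
    with \<pp> coset[OF x(1)] show "\<pp> \<in> Ass R ?Q"
      by (auto simp: Ass_def)
  next
    fix \<pp> assume "\<pp> \<in> weak_Ass R M - Var R \<aa>"
    then obtain x where \<pp>: "primeideal \<pp> R" "\<not> \<aa> \<subseteq> \<pp>"
      and x: "x \<in> carrier M" "elt_ann R M x \<subseteq> \<pp>"
      and min: "\<And>\<qq>. \<qq> \<in> Var R (elt_ann R M x) \<Longrightarrow> \<qq> \<subseteq> \<pp> \<Longrightarrow> \<qq> = \<pp>"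
      by (auto simp: weak_Ass_def Var_def)
    have "\<pp> \<in> Var R (elt_ann R ?Q (?T +>\<^bsub>M\<^esub> x))"
      using bound[OF x(1) \<pp>(1) x(2) \<pp>(2)] \<pp>(1) by (simp add: Var_def)
    moreover have "\<qq> = \<pp>" if "\<qq> \<in> Var R (elt_ann R ?Q (?T +>\<^bsub>M\<^esub> x))" "\<qq> \<subseteq> \<pp>" for \<qq>
      using that min enlarge[OF x(1)] by (auto simp: Var_def)
    ultimately show "\<pp> \<in> weak_Ass R ?Q"
      using \<pp>(1) coset[OF x(1)] unfolding weak_Ass_def by blast
  qed
qed

end
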